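(* Let $X$ be a represented space and $Y$ a computable metric space. Then every weakly computable single-valued function $f:\subseteq X\to Y$ is computable.
   Context: A represented space $(X,\delta_X)$ is a set $X$ with a surjective partial map $\delta_X:\subseteq\mathbb{N}^{\mathbb{N}}\to X$. A multi-valued function $f:\subseteq X\rightrightarrows Y$ assigns to each $x$ a set $f(x)\subseteq Y$, with $\mathrm{dom}(f)=\{x: f(x)\neq\emptyset\}$; it is single-valued if $f(x)$ is a singleton for each $x\in\mathrm{dom}(f)$. A realizer of $f$ is a partial $F:\subseteq\mathbb{N}^{\mathbb{N}}\to\mathbb{N}^{\mathbb{N}}$ such that $F(p)$ is defined and $\delta_YF(p)\in f(\delta_X(p))$ whenever $\delta_X(p)\in\mathrm{dom}(f)$. $f$ is computable if it has a computable realizer. $f\leq_{\mathrm W}g$ iff there are computable $H,K:\subseteq\mathbb{N}^{\mathbb{N}}\to\mathbb{N}^{\mathbb{N}}$ such that for every realizer $G$ of $g$ the function $p\mapsto H\langle p,GK(p)\rangle$ is a realizer of $f$, where $\langle\cdot,\cdot\rangle$ is a computable pairing on $\mathbb{N}^{\mathbb{N}}$. $\mathsf{LLPO}:\subseteq\mathbb{N}^{\mathbb{N}}\rightrightarrows\mathbb{N}$ has domain $\{p: p(k)\neq0\text{ for at most one }k\}$ and values in $\{0,1\}$, with $0\in\mathsf{LLPO}(p)\iff(\forall n)\,p(2n)=0$ and $1\in\mathsf{LLPO}(p)\iff(\forall n)\,p(2n+1)=0$. $\widehat{\mathsf{LLPO}}:\subseteq\mathbb{N}^{\mathbb{N}}\rightrightarrows\mathbb{N}^{\mathbb{N}}$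 is $\widehat{\mathsf{LLPO}}\langle p_0,p_1,\dots\rangle=\{q:(\forall k)\,q(k)\in\mathsf{LLPO}(p_k)\}$, defined when all $p_k\in\mathrm{dom}(\mathsf{LLPO})$, where $\langle p_0,p_1,\dots\rangle\langle k,n\rangle=p_k(n)$. $f$ is called weakly computable if $f\leq_{\mathrm W}\widehat{\mathsf{LLPO}}$. $\mathbb{N}^{\mathbb{N}}$ is represented by the identity. A computable metric space $(Y,d,\alpha)$ is a metric space $(Y,d)$ with a dense sequence $\alpha:\mathbb{N}\to Y$ such that $(i,j)\mapsto d(\alpha(i),\alpha(j))$ is a computable double sequence of reals. It is represented by the Cauchy representation: $p$ names $y$ iff $d(\alpha(p(i)),\alpha(p(j)))\leq2^{-j}$ for all $i>j$ and $\alpha(p(i))\to y$. *)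

theory Defs
  imports "HOL-Analysis.Analysis" "HOL-Library.Nat_Bijection"
begin

type_synonym baire = "nat \<Rightarrow> nat"

section \<open>Computability on Baire space\<close>

text \<open>
  Computability is recursiveness in a function argument, uniformly in that argument: a partial
  recursive functional sends \<open>p\<close> and \<open>n\<close> to the result of a machine that is run on \<open>n\<close> and may
  query values of \<open>p\<close> (\<open>None\<close> for divergence).  The class is generated by Kleene's schemes.
  Functions of several arguments are coded as unary ones through the bijection \<open>prod_encode\<close>,
  so that the two projections and pairing replace the usual projection and tupling schemes.
\<close>

primrec prim_iter ::
  "(nat \<rightharpoonup> nat) \<Rightarrow> (nat \<rightharpoonup> nat) \<Rightarrow> nat \<Rightarrow> nat \<Rightarrow> nat option" where
  "prim_iter f g a 0 = f a"
| "prim_iter f g a (Suc m) =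
    Option.bind (prim_iter f g a m) (\<lambda>r. g (prod_encode (a, prod_encode (m, r))))"

definition mu_search :: "(nat \<rightharpoonup> nat) \<Rightarrow> nat \<rightharpoonup> nat" where
  "mu_search f a =
    (if \<exists>n. f (prod_encode (a, n)) = Some 0 \<and> (\<forall>m<n. f (prod_encode (a, m)) \<noteq> None)
     then Some (LEAST n. f (prod_encode (a, n)) = Some 0) else None)"

inductive partial_recursive :: "(baire \<Rightarrow> nat \<rightharpoonup> nat) \<Rightarrow> bool" where
  zero: "partial_recursive (\<lambda>p n. Some 0)"
| succ: "partial_recursive (\<lambda>p n. Some (Suc n))"
| left: "partial_recursive (\<lambda>p n. Some (fst (prod_decode n)))"
| right: "partial_recursive (\<lambda>p n. Some (snd (prod_decode n)))"
| query: "partial_recursive (\<lambda>p n. Some (p n))"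
| pair: "partial_recursive f \<Longrightarrow> partial_recursive g \<Longrightarrow>
    partial_recursive
      (\<lambda>p n. Option.bind (f p n) (\<lambda>a. Option.bind (g p n) (\<lambda>b. Some (prod_encode (a, b)))))"
| comp: "partial_recursive f \<Longrightarrow> partial_recursive g \<Longrightarrow>
    partial_recursive (\<lambda>p n. Option.bind (g p n) (f p))"
| prim: "partial_recursive f \<Longrightarrow> partial_recursive g \<Longrightarrow>
    partial_recursive
      (\<lambda>p n. prim_iter (f p) (g p) (fst (prod_decode n)) (snd (prod_decode n)))"
| mu: "partial_recursive f \<Longrightarrow> partial_recursive (\<lambda>p n. mu_search (f p) n)"

definition computable_nat :: "(nat \<Rightarrow> nat) \<Rightarrow> bool" where
  "computable_nat g \<longleftrightarrow> (\<exists>\<Phi>. partial_recursive \<Phi> \<and> (\<forall>n. \<Phi> (\<lambda>_. 0) n = Some (g n)))"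

text \<open>
  No condition is imposed on the machine outside the domain of \<open>F\<close>.  Since an extension of a
  realizer is again a realizer, the notions below do not change if the domain of \<open>F\<close> is required
  to be exactly the set of \<open>p\<close> for which all outputs converge.
\<close>

definition computable_baire :: "(baire \<rightharpoonup> baire) \<Rightarrow> bool" where
  "computable_baire F \<longleftrightarrow>
    (\<exists>\<Phi>. partial_recursive \<Phi> \<and> (\<forall>p q. F p = Some q \<longrightarrow> (\<forall>n. \<Phi> p n = Some (q n))))"

definition baire_pair :: "baire \<Rightarrow> baire \<Rightarrow> baire" where
  "baire_pair p q n = (if even n then p (n div 2) else q (n div 2))"

section \<open>Represented spaces and Weihrauch reducibility\<close>

text \<open>The representation is a partial map; its range is the carrier.\<close>

definition represented_space :: "'x set \<Rightarrow> (baire \<rightharpoonup> 'x) \<Rightarrow> bool" where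
  "represented_space X \<delta> \<longleftrightarrow> ran \<delta> = X"

text \<open>A partial multi-valued function is a set-valued map; the empty value means undefined.\<close>

definition multifun_dom :: "('x \<Rightarrow> 'y set) \<Rightarrow> 'x set" where
  "multifun_dom f = {x. f x \<noteq> {}}"

definition multifun :: "'x set \<Rightarrow> 'y set \<Rightarrow> ('x \<Rightarrow> 'y set) \<Rightarrow> bool" where
  "multifun X Y f \<longleftrightarrow> multifun_dom f \<subseteq> X \<and> (\<forall>x\<in>X. f x \<subseteq> Y)"

definition single_valued_multifun :: "('x \<Rightarrow> 'y set) \<Rightarrow> bool" where
  "single_valued_multifun f \<longleftrightarrow> (\<forall>x\<in>multifun_dom f. is_singleton (f x))"

definition realizer ::
  "(baire \<rightharpoonup> 'x) \<Rightarrow> (baire \<rightharpoonup> 'y) \<Rightarrow> ('x \<Rightarrow> 'y set) \<Rightarrow> (baire \<rightharpoonup> baire) \<Rightarrow> bool" where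
  "realizer \<delta>X \<delta>Y f F \<longleftrightarrow>
    (\<forall>p x. \<delta>X p = Some x \<and> x \<in> multifun_dom f \<longrightarrow>
      (\<exists>q y. F p = Some q \<and> \<delta>Y q = Some y \<and> y \<in> f x))"

definition computable_multifun ::
  "(baire \<rightharpoonup> 'x) \<Rightarrow> (baire \<rightharpoonup> 'y) \<Rightarrow> ('x \<Rightarrow> 'y set) \<Rightarrow> bool" where
  "computable_multifun \<delta>X \<delta>Y f \<longleftrightarrow> (\<exists>F. computable_baire F \<and> realizer \<delta>X \<delta>Y f F)"

definition weihrauch_reducible ::
  "(baire \<rightharpoonup> 'x) \<Rightarrow> (baire \<rightharpoonup> 'y) \<Rightarrow> ('x \<Rightarrow> 'y set) \<Rightarrow>
   (baire \<rightharpoonup> 'z) \<Rightarrow> (baire \<rightharpoonup> 'w) \<Rightarrow> ('z \<Rightarrow> 'w set) \<Rightarrow> bool" where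
  "weihrauch_reducible \<delta>X \<delta>Y f \<delta>Z \<delta>W g \<longleftrightarrow>
    (\<exists>H K. computable_baire H \<and> computable_baire K \<and>
      (\<forall>G. realizer \<delta>Z \<delta>W g G \<longrightarrow>
        realizer \<delta>X \<delta>Y f
          (\<lambda>p. Option.bind (K p) (\<lambda>r. Option.bind (G r) (\<lambda>q. H (baire_pair p q))))))"

section \<open>Weak computability\<close>

definition LLPO :: "baire \<Rightarrow> nat set" where
  "LLPO p =
    (if Uniq (\<lambda>k. p k \<noteq> 0)
     then {i. i = 0 \<and> (\<forall>n. p (2 * n) = 0) \<or> i = 1 \<and> (\<forall>n. p (2 * n + 1) = 0)}
     else {})"

text \<open>
  The component \<open>p\<^sub>k\<close> of \<open>r = \<langle>p\<^sub>0, p\<^sub>1, \<dots>\<rangle>\<close> is \<open>\<lambda>n. r (prod_encode (k, n))\<close>.  If some \<open>p\<^sub>k\<close> is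
  outside the domain of \<open>LLPO\<close>, the value below is empty, i.e. undefined.
\<close>

definition LLPO_hat :: "baire \<Rightarrow> baire set" where
  "LLPO_hat r = {q. \<forall>k. q k \<in> LLPO (\<lambda>n. r (prod_encode (k, n)))}"

text \<open>\<open>Some\<close> is the identity representation of Baire space.\<close>

definition weakly_computable ::
  "(baire \<rightharpoonup> 'x) \<Rightarrow> (baire \<rightharpoonup> 'y) \<Rightarrow> ('x \<Rightarrow> 'y set) \<Rightarrow> bool" where
  "weakly_computable \<delta>X \<delta>Y f \<longleftrightarrow> weihrauch_reducible \<delta>X \<delta>Y f Some Some LLPO_hat"

section \<open>Computable metric spaces\<close>

text \<open>
  A double sequence of reals is computable if some computable triple sequence of rationals
  \<open>(-1) ^ s * a / b\<close> converges to it effectively.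
\<close>

definition computable_real_double_seq :: "(nat \<Rightarrow> nat \<Rightarrow> real) \<Rightarrow> bool" where
  "computable_real_double_seq x \<longleftrightarrow>
    (\<exists>s a b. computable_nat s \<and> computable_nat a \<and> computable_nat b \<and> (\<forall>n. b n \<noteq> 0) \<and>
      (\<forall>i j k. let n = prod_encode (i, prod_encode (j, k)) in
        \<bar>x i j - (-1) ^ s n * real (a n) / real (b n)\<bar> \<le> (1/2) ^ k))"

definition computable_metric_space ::
  "'y set \<Rightarrow> ('y \<Rightarrow> 'y \<Rightarrow> real) \<Rightarrow> (nat \<Rightarrow> 'y) \<Rightarrow> bool" where
  "computable_metric_space Y d \<alpha> \<longleftrightarrow>
    Metric_space Y d \<and> range \<alpha> \<subseteq> Y \<and>
    Metric_space.mtopology Y d closure_of range \<alpha> = Y \<and>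
    computable_real_double_seq (\<lambda>i j. d (\<alpha> i) (\<alpha> j))"

definition cauchy_name ::
  "'y set \<Rightarrow> ('y \<Rightarrow> 'y \<Rightarrow> real) \<Rightarrow> (nat \<Rightarrow> 'y) \<Rightarrow> baire \<Rightarrow> 'y \<Rightarrow> bool" where
  "cauchy_name Y d \<alpha> p y \<longleftrightarrow>
    (\<forall>i j. i > j \<longrightarrow> d (\<alpha> (p i)) (\<alpha> (p j)) \<le> (1/2) ^ j) \<and>
    limitin (Metric_space.mtopology Y d) (\<lambda>i. \<alpha> (p i)) y sequentially"

definition cauchy_rep ::
  "'y set \<Rightarrow> ('y \<Rightarrow> 'y \<Rightarrow> real) \<Rightarrow> (nat \<Rightarrow> 'y) \<Rightarrow> baire \<rightharpoonup> 'y" where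
  "cauchy_rep Y d \<alpha> p =
    (if \<exists>y. cauchy_name Y d \<alpha> p y then Some (THE y. cauchy_name Y d \<alpha> p y) else None)"

lemma cauchy_rep_eq_Some_iff:
  assumes "Metric_space Y d"
  shows "cauchy_rep Y d \<alpha> p = Some y \<longleftrightarrow> cauchy_name Y d \<alpha> p y"
proof -
  interpret Metric_space Y d by fact
  have "z = z'" if "cauchy_name Y d \<alpha> p z" "cauchy_name Y d \<alpha> p z'" for z z'
    using that limitin_metric_unique[of _ z sequentially z'] unfolding cauchy_name_def by auto
  then show ?thesis
    unfolding cauchy_rep_def by (auto intro: theI the_equality)
qed

lemma represented_space_cauchy_rep:
  assumes "computable_metric_space Y d \<alpha>"
  shows "represented_space Y (cauchy_rep Y d \<alpha>)"
proof -
  interpret Metric_space Y d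
    using assms by (simp add: computable_metric_space_def)
  have sub: "range \<alpha> \<subseteq> Y" and dense: "mtopology closure_of range \<alpha> = Y"
    using assms by (auto simp: computable_metric_space_def)
  have "\<exists>p. cauchy_name Y d \<alpha> p y" if y: "y \<in> Y" for y
  proof -
    have "\<exists>n. d (\<alpha> n) y < (1/2) ^ j / 2" for j :: nat
    proof -
      have "y \<in> mtopology closure_of range \<alpha>" using y dense by simp
      moreover have "(0::real) < (1/2) ^ j / 2" by simp
      ultimately have "\<exists>z \<in> range \<alpha>. z \<in> mball y ((1/2) ^ j / 2)"
        unfolding metric_closure_of by blast
      then show ?thesis by (auto simp: commute)
    qed
    then obtain p where p: "\<And>j. d (\<alpha> (p j)) y < (1/2) ^ j / 2" by metis
    have mem: "\<alpha> n \<in> Y" for n using sub by auto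
    have "d (\<alpha> (p i)) (\<alpha> (p j)) \<le> (1/2) ^ j" if "i > j" for i j
    proof -
      have "d (\<alpha> (p i)) (\<alpha> (p j)) \<le> d (\<alpha> (p i)) y + d (\<alpha> (p j)) y"
        using triangle[of "\<alpha> (p i)" y "\<alpha> (p j)"] mem y by (simp add: commute)
      moreover have "(1/2::real) ^ i \<le> (1/2) ^ j" using that by (simp add: power_decreasing)
      ultimately show ?thesis using p[of i] p[of j] by linarith
    qed
    moreover have "limitin mtopology (\<lambda>i. \<alpha> (p i)) y sequentially"
      unfolding limitin_metric_dist_null
    proof (intro conjI y)
      show "\<forall>\<^sub>F i in sequentially. \<alpha> (p i) \<in> Y" using mem by simp
      have "(\<lambda>i. (1/2::real) ^ i / 2) \<longlonglongrightarrow> 0"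
        by (intro tendsto_divide_zero LIMSEQ_power_zero) simp
      then show "(\<lambda>i. d (\<alpha> (p i)) y) \<longlonglongrightarrow> 0"
        by (rule Lim_null_comparison[rotated]) (use p in \<open>auto intro!: always_eventually less_imp_le\<close>)
    qed
    ultimately show ?thesis unfolding cauchy_name_def by blast
  qed
  moreover have "y \<in> Y" if "cauchy_name Y d \<alpha> p y" for p y
    using that limitin_topspace[of mtopology] unfolding cauchy_name_def by fastforce
  ultimately show ?thesis
    unfolding represented_space_def ran_def
    by (auto simp: cauchy_rep_eq_Some_iff[OF Metric_space_axioms])
qed

end

theory Submission
  imports Defs
begin

text \<open>
  Let \<open>p\<close> be a name of a point \<open>x\<close> and let \<open>y\<close> be the only value of \<open>f\<close> at \<open>x\<close>.  The reduction
  computes from \<open>p\<close> an instance \<open>r\<close> of the parallelization of \<open>LLPO\<close>.  Its solutions form a nonempty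
  closed subset of Cantor space, and from \<open>p\<close> together with any solution \<open>q\<close> a functional
  \<open>\<Phi>\<close> computes a Cauchy name of \<open>y\<close>.  In general no solution can be computed from \<open>r\<close>, but compactness
  allows all of them to be treated at once.  That an infinite binary word is not a solution becomes visible on a finite prefix and at a finite
  stage of \<open>r\<close>; that \<open>\<Phi>\<close> produces a good approximation of \<open>y\<close> from a solution is also
  visible on a finite prefix.  As all solutions lead to the same \<open>y\<close>, one index \<open>i\<close> with \<open>\<alpha> i\<close>
  close to \<open>y\<close> fits all these approximations, and by compactness one stage \<open>s\<close> suffices for all
  words: every \<open>u\<close> of length \<open>s\<close> is then either contradicted by \<open>r\<close> or makes \<open>\<Phi>\<close> output the index
  of a point close to \<open>\<alpha> i\<close>.  With closeness tested up to a
  tolerance, this property of \<open>s\<close> and \<open>i\<close> is decidable relative to \<open>p\<close> and \<open>r\<close>, so such a pair can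
  be searched for.  Conversely, any pair
  found in this way has \<open>\<alpha> i\<close> close to \<open>y\<close>, because a prefix of an actual solution is among
  the words and cannot be contradicted.

  Two facts about partial recursive functionals make the search effective.  Lemma
  \<open>ex_prefix_approximation\<close> turns \<open>\<Phi>\<close> into a total functional that receives a stage and a finite
  word in place of the second half of the oracle and answers only if these suffice.  The total
  functional is built by induction on the schemes that generate \<open>\<Phi>\<close>.
  Lemma \<open>oracle_substitution\<close> lets the search, which is a functional of \<open>p\<close> and \<open>r\<close>, run on the
  \<open>r\<close> that is itself computed from \<open>p\<close>.  Compactness enters through \<open>compact_Cantor_stages\<close>.
\<close>

section \<open>Total recursive functionals\<close>

definition total_recursive :: "(baire \<Rightarrow> nat \<Rightarrow> nat) \<Rightarrow> bool" where
  "total_recursive g \<longleftrightarrow> partial_recursive (\<lambda>p n. Some (g p n))"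

definition decidable :: "(baire \<Rightarrow> nat \<Rightarrow> bool) \<Rightarrow> bool" where
  "decidable t \<longleftrightarrow> total_recursive (\<lambda>p n. of_bool (t p n))"

named_theorems recursive_intros

lemma total_recursive_Suc_self: "total_recursive (\<lambda>p n. Suc n)"
  unfolding total_recursive_def by (rule partial_recursive.succ)

lemma total_recursive_comp:
  assumes "total_recursive f" "total_recursive g"
  shows "total_recursive (\<lambda>p n. f p (g p n))"
  using partial_recursive.comp[OF assms[unfolded total_recursive_def]]
  by (simp add: total_recursive_def)

lemma total_recursive_oracle [recursive_intros]:
  "total_recursive g \<Longrightarrow> total_recursive (\<lambda>p n. p (g p n))"
  using total_recursive_comp[of "\<lambda>p n. p n" g] partial_recursive.query
  by (simp add: total_recursive_def)

lemma total_recursive_Suc [recursive_intros]: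
  "total_recursive g \<Longrightarrow> total_recursive (\<lambda>p n. Suc (g p n))"
  by (rule total_recursive_comp[OF total_recursive_Suc_self])

lemma total_recursive_fst [recursive_intros]:
  "total_recursive g \<Longrightarrow> total_recursive (\<lambda>p n. fst (prod_decode (g p n)))"
  using total_recursive_comp[of "\<lambda>p n. fst (prod_decode n)" g] partial_recursive.left
  by (simp add: total_recursive_def)

lemma total_recursive_snd [recursive_intros]:
  "total_recursive g \<Longrightarrow> total_recursive (\<lambda>p n. snd (prod_decode (g p n)))"
  using total_recursive_comp[of "\<lambda>p n. snd (prod_decode n)" g] partial_recursive.right
  by (simp add: total_recursive_def)

lemma total_recursive_pair [recursive_intros]:
  assumes "total_recursive f" "total_recursive g"
  shows "total_recursive (\<lambda>p n. prod_encode (f p n, g p n))"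
  using partial_recursive.pair[OF assms[unfolded total_recursive_def]]
  by (simp add: total_recursive_def)

lemma total_recursive_id [recursive_intros]: "total_recursive (\<lambda>p n. n)"
  using total_recursive_pair[of "\<lambda>p n. fst (prod_decode n)" "\<lambda>p n. snd (prod_decode n)"]
    partial_recursive.left partial_recursive.right
  by (simp add: total_recursive_def)

lemma total_recursive_const [recursive_intros]: "total_recursive (\<lambda>p n. c)"
proof (induction c)
  case 0
  then show ?case unfolding total_recursive_def by (rule partial_recursive.zero)
next
  case (Suc c)
  then show ?case by (rule total_recursive_Suc)
qed

text \<open>
  The step function may use the parameter \<open>n\<close> directly in the conclusion; the assumption on it
  supplies parameter, counter and previous value in one coded argument, as the primitive recursion
  scheme does.
\<close>

lemma total_recursive_rec_nat [recursive_intros]: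
  assumes f: "total_recursive f" and h: "total_recursive h"
    and g: "total_recursive (\<lambda>p x. g p (fst (prod_decode x)) (fst (prod_decode (snd (prod_decode x))))
      (snd (prod_decode (snd (prod_decode x)))))"
  shows "total_recursive (\<lambda>p n. rec_nat (f p n) (g p n) (h p n))"
proof -
  let ?g = "\<lambda>p x. g p (fst (prod_decode x)) (fst (prod_decode (snd (prod_decode x))))
      (snd (prod_decode (snd (prod_decode x))))"
  have "prim_iter (\<lambda>x. Some (f p x)) (\<lambda>x. Some (?g p x)) a m = Some (rec_nat (f p a) (g p a) m)"
    for p a m by (induction m) simp_all
  then have "total_recursive (\<lambda>p n. rec_nat (f p (fst (prod_decode n)))
      (g p (fst (prod_decode n))) (snd (prod_decode n)))"
    using partial_recursive.prim[OF f[unfolded total_recursive_def] g[unfolded total_recursive_def]]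
    by (simp add: total_recursive_def)
  from total_recursive_comp[OF this total_recursive_pair[OF total_recursive_id h]]
  show ?thesis by simp
qed

lemma total_recursive_add [recursive_intros]:
  assumes "total_recursive f" "total_recursive g"
  shows "total_recursive (\<lambda>p n. f p n + g p n)"
proof -
  have "a + b = rec_nat a (\<lambda>m r. Suc r) b" for a b :: nat by (induction b) simp_all
  then show ?thesis by (simp only:) (intro recursive_intros assms)
qed

lemma total_recursive_pred [recursive_intros]:
  assumes "total_recursive f"
  shows "total_recursive (\<lambda>p n. f p n - 1)"
proof -
  have "a - 1 = rec_nat 0 (\<lambda>m r. m) a" for a :: nat by (cases a) simp_all
  then show ?thesis by (simp only:) (intro recursive_intros assms)
qed

lemma total_recursive_diff [recursive_intros]:
  assumes "total_recursive f" "total_recursive g"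
  shows "total_recursive (\<lambda>p n. f p n - g p n)"
proof -
  have eq: "a - b = rec_nat a (\<lambda>m r. r - 1) b" for a b :: nat
  proof (induction b)
    case (Suc b)
    then show ?case by (simp flip: Suc)
  qed simp
  have "(\<lambda>p n. f p n - g p n) = (\<lambda>p n. rec_nat (f p n) (\<lambda>m r. r - 1) (g p n))"
    by (intro ext eq)
  then show ?thesis by (elim ssubst) (intro recursive_intros assms)
qed

lemma total_recursive_mult [recursive_intros]:
  assumes "total_recursive f" "total_recursive g"
  shows "total_recursive (\<lambda>p n. f p n * g p n)"
proof -
  \<comment> \<open>In the step, \<open>f\<close> is evaluated at the parameter, which is a projection of the coded argument;
    hence the composition rule for \<open>f\<close>.\<close>
  have "a * b = rec_nat 0 (\<lambda>m r. r + a) b" for a b :: nat by (induction b) simp_all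
  then show ?thesis by (simp only:) (intro recursive_intros total_recursive_comp[OF assms(1)] assms)
qed

lemma total_recursive_power [recursive_intros]:
  assumes "total_recursive f" "total_recursive g"
  shows "total_recursive (\<lambda>p n. f p n ^ g p n)"
proof -
  have "a ^ b = rec_nat 1 (\<lambda>m r. r * a) b" for a b :: nat by (induction b) simp_all
  then show ?thesis by (simp only:) (intro recursive_intros total_recursive_comp[OF assms(1)] assms)
qed

lemma decidable_not [recursive_intros]:
  assumes "decidable t"
  shows "decidable (\<lambda>p n. \<not> t p n)"
proof -
  have "of_bool (\<not> b) = 1 - (of_bool b :: nat)" for b by simp
  then show ?thesis using assms unfolding decidable_def
    by (simp only:) (intro recursive_intros)
qed

lemma decidable_conj [recursive_intros]:
  assumes "decidable t" "decidable t'"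
  shows "decidable (\<lambda>p n. t p n \<and> t' p n)"
  using assms unfolding decidable_def of_bool_conj by (intro recursive_intros)

lemma decidable_disj [recursive_intros]:
  assumes "decidable t" "decidable t'"
  shows "decidable (\<lambda>p n. t p n \<or> t' p n)"
proof -
  have "decidable (\<lambda>p n. \<not> (\<not> t p n \<and> \<not> t' p n))" by (intro recursive_intros assms)
  then show ?thesis by simp
qed

lemma decidable_le [recursive_intros]:
  assumes "total_recursive f" "total_recursive g"
  shows "decidable (\<lambda>p n. f p n \<le> g p n)"
proof -
  have "of_bool (a \<le> b) = 1 - (a - b)" for a b :: nat by auto
  then show ?thesis unfolding decidable_def by (simp only:) (intro recursive_intros assms)
qed

lemma decidable_less [recursive_intros]:
  assumes "total_recursive f" "total_recursive g"
  shows "decidable (\<lambda>p n. f p n < g p n)"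
  unfolding Suc_le_eq[symmetric] by (intro recursive_intros assms)

lemma decidable_eq [recursive_intros]:
  assumes "total_recursive f" "total_recursive g"
  shows "decidable (\<lambda>p n. f p n = g p n)"
  unfolding order_eq_iff by (intro recursive_intros assms)

lemma total_recursive_If [recursive_intros]:
  assumes "decidable t" "total_recursive f" "total_recursive g"
  shows "total_recursive (\<lambda>p n. if t p n then f p n else g p n)"
proof -
  have "(if b then x else y) = of_bool b * x + (1 - of_bool b) * y" for b and x y :: nat by simp
  then show ?thesis using assms unfolding decidable_def by (simp only:) (intro recursive_intros)
qed

lemma total_recursive_of_bool [recursive_intros]:
  "decidable t \<Longrightarrow> total_recursive (\<lambda>p n. of_bool (t p n))"
  by (simp add: decidable_def)

lemma decidable_comp:
  assumes "decidable t" "total_recursive g"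
  shows "decidable (\<lambda>p n. t p (g p n))"
  using total_recursive_comp[OF assms(1)[unfolded decidable_def] assms(2)]
  by (simp add: decidable_def)

text \<open>
  Bounded search is primitive recursive: the iteration keeps the counter as its value as long as
  no solution has been met, and is constant afterwards.
\<close>

lemma total_recursive_bounded_Least [recursive_intros]:
  assumes t: "decidable (\<lambda>p x. t p (fst (prod_decode x)) (snd (prod_decode x)))"
    and b: "total_recursive b"
  shows "total_recursive (\<lambda>p n. LEAST m. t p n m \<or> b p n \<le> m)"
proof -
  have eq: "(LEAST m. s m \<or> b \<le> m) = rec_nat 0 (\<lambda>m r. if r = m \<and> \<not> s m then Suc m else r) b"
    for s and b :: nat
  proof -
    let ?r = "rec_nat 0 (\<lambda>m r. if r = m \<and> \<not> s m then Suc m else r)"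
    have "?r b \<le> b \<and> (?r b < b \<longrightarrow> s (?r b)) \<and> (\<forall>m < ?r b. \<not> s m)"
      by (induction b) (auto simp: less_Suc_eq)
    then show ?thesis by (intro Least_equality) (auto simp: not_less[symmetric])
  qed
  have "total_recursive (\<lambda>p n. rec_nat 0 (\<lambda>m r. if r = m \<and> \<not> t p n m then Suc m else r) (b p n))"
    using decidable_comp[OF t total_recursive_pair[OF
        total_recursive_fst[OF total_recursive_id]
        total_recursive_fst[OF total_recursive_snd[OF total_recursive_id]]]]
    by (intro recursive_intros b) simp
  then show ?thesis by (simp only: eq)
qed

lemma decidable_ball_less [recursive_intros]:
  assumes t: "decidable (\<lambda>p x. t p (fst (prod_decode x)) (snd (prod_decode x)))"
    and b: "total_recursive b"
  shows "decidable (\<lambda>p n. \<forall>m < b p n. t p n m)"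
proof -
  have "(\<forall>m<b. s m) \<longleftrightarrow> b \<le> (LEAST m. \<not> s m \<or> b \<le> m)" for s and b :: nat
    using LeastI[of "\<lambda>m. \<not> s m \<or> b \<le> m" b] not_less_Least[of _ "\<lambda>m. \<not> s m \<or> b \<le> m"]
    by (metis le_eq_less_or_eq not_less)
  moreover have "decidable (\<lambda>p n. b p n \<le> (LEAST m. \<not> t p n m \<or> b p n \<le> m))"
    by (intro recursive_intros t b)
  ultimately show ?thesis by presburger
qed

lemma decidable_bex_less [recursive_intros]:
  assumes "decidable (\<lambda>p x. t p (fst (prod_decode x)) (snd (prod_decode x)))"
    and "total_recursive b"
  shows "decidable (\<lambda>p n. \<exists>m < b p n. t p n m)"
proof -
  have "decidable (\<lambda>p n. \<not> (\<forall>m < b p n. \<not> t p n m))" by (intro recursive_intros assms)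
  then show ?thesis by simp
qed

lemma total_recursive_div_power2 [recursive_intros]:
  assumes "total_recursive f" "total_recursive g"
  shows "total_recursive (\<lambda>p n. f p n div 2 ^ g p n)"
proof -
  have eq: "a div 2 ^ b = (LEAST m. a < Suc m * 2 ^ b \<or> a \<le> m)" for a b :: nat
  proof (rule Least_equality[symmetric])
    show "a < Suc (a div 2 ^ b) * 2 ^ b \<or> a \<le> a div 2 ^ b"
      using dividend_less_div_times[of "2 ^ b" a] by simp
  next
    fix m assume "a < Suc m * 2 ^ b \<or> a \<le> m"
    then show "a div 2 ^ b \<le> m"
      by (metis div_le_dividend le_trans less_Suc_eq_le less_mult_imp_div_less)
  qed
  show ?thesis unfolding eq
    by (intro recursive_intros total_recursive_comp[OF assms(1)] total_recursive_comp[OF assms(2)]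
        assms)
qed

lemma total_recursive_half [recursive_intros]:
  "total_recursive f \<Longrightarrow> total_recursive (\<lambda>p n. f p n div 2)"
  using total_recursive_div_power2[of f "\<lambda>p n. 1"] total_recursive_const by simp

lemma decidable_even [recursive_intros]:
  assumes "total_recursive f"
  shows "decidable (\<lambda>p n. even (f p n))"
proof -
  have "even a \<longleftrightarrow> 2 * (a div 2) = a" for a :: nat
    by (metis dvd_mult_div_cancel dvd_triv_left)
  then show ?thesis by (simp only:) (intro recursive_intros assms)
qed

lemma decidable_bit [recursive_intros]:
  assumes "total_recursive f" "total_recursive g"
  shows "decidable (\<lambda>p n. bit (f p n) (g p n))"
  unfolding bit_iff_odd by (intro recursive_intros assms)

section \<open>Replacing the oracle\<close>

text \<open>
  In a program for \<open>\<Phi>\<close> every oracle query can be answered by running \<open>\<Psi>\<close>.  The result is compared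
  with \<open>\<Phi>\<close> only at those \<open>p\<close> at which \<open>\<Psi>\<close> computes a complete oracle.
\<close>

lemma oracle_substitution:
  assumes "partial_recursive \<Phi>" and \<Psi>: "partial_recursive \<Psi>"
  shows "\<exists>\<Theta>. partial_recursive \<Theta> \<and> (\<forall>p q. (\<forall>n. \<Psi> p n = Some (q n)) \<longrightarrow> \<Theta> p = \<Phi> q)"
  using assms(1)
proof induction
  case zero
  show ?case using partial_recursive.zero by blast
next
  case succ
  show ?case using partial_recursive.succ by blast
next
  case left
  show ?case using partial_recursive.left by blast
next
  case right
  show ?case using partial_recursive.right by blast
next
  case query
  show ?case using \<Psi> by blast
next
  case (pair f g)
  then obtain f' g' where "partial_recursive f'" "partial_recursive g'"
    and eq: "\<And>p q. (\<forall>n. \<Psi> p n = Some (q n)) \<Longrightarrow> f' p = f q \<and> g' p = g q" by metis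
  then show ?case
    by (intro exI[of _ "\<lambda>p n. Option.bind (f' p n) (\<lambda>a. Option.bind (g' p n)
      (\<lambda>b. Some (prod_encode (a, b))))"]) (auto intro: partial_recursive.pair dest!: eq)
next
  case (comp f g)
  then obtain f' g' where "partial_recursive f'" "partial_recursive g'"
    and eq: "\<And>p q. (\<forall>n. \<Psi> p n = Some (q n)) \<Longrightarrow> f' p = f q \<and> g' p = g q" by metis
  then show ?case
    by (intro exI[of _ "\<lambda>p n. Option.bind (g' p n) (f' p)"]) (auto intro: partial_recursive.comp dest!: eq)
next
  case (prim f g)
  then obtain f' g' where "partial_recursive f'" "partial_recursive g'"
    and eq: "\<And>p q. (\<forall>n. \<Psi> p n = Some (q n)) \<Longrightarrow> f' p = f q \<and> g' p = g q" by metis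
  then show ?case
    by (intro exI[of _ "\<lambda>p n. prim_iter (f' p) (g' p) (fst (prod_decode n)) (snd (prod_decode n))"])
      (auto intro: partial_recursive.prim dest!: eq)
next
  case (mu f)
  then obtain f' where "partial_recursive f'"
    and eq: "\<And>p q. (\<forall>n. \<Psi> p n = Some (q n)) \<Longrightarrow> f' p = f q" by metis
  then show ?case
    by (intro exI[of _ "\<lambda>p n. mu_search (f' p) n"]) (auto intro: partial_recursive.mu dest!: eq)
qed

lemma total_recursive_oracle_substitution:
  assumes "total_recursive f" and "total_recursive g"
  shows "total_recursive (\<lambda>p. f (g p))"
proof -
  obtain \<Theta> where "partial_recursive \<Theta>" "\<And>p. \<Theta> p = (\<lambda>n. Some (f (g p) n))"
    using oracle_substitution[OF assms[unfolded total_recursive_def]] by blast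
  moreover from this have "\<Theta> = (\<lambda>p n. Some (f (g p) n))" by blast
  ultimately show ?thesis by (simp add: total_recursive_def)
qed

text \<open>
  Computability of a number function refers to the zero oracle, which is substituted here in order
  to use the function inside a functional with an arbitrary oracle.
\<close>

lemma total_recursive_computable_nat:
  assumes "computable_nat g" and "total_recursive f"
  shows "total_recursive (\<lambda>p n. g (f p n))"
proof -
  obtain \<Phi> where \<Phi>: "partial_recursive \<Phi>" "\<And>n. \<Phi> (\<lambda>_. 0) n = Some (g n)"
    using assms(1) unfolding computable_nat_def by blast
  obtain \<Theta> where "partial_recursive \<Theta>" "\<And>p. \<Theta> p = \<Phi> (\<lambda>_. 0)"
    using oracle_substitution[OF \<Phi>(1) partial_recursive.zero] by auto
  moreover from this \<Phi>(2) have "\<Theta> = (\<lambda>p n. Some (g n))" by (simp add: fun_eq_iff)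
  ultimately have "total_recursive (\<lambda>p. g)" by (simp add: total_recursive_def)
  from total_recursive_comp[OF this assms(2)] show ?thesis .
qed

section \<open>Unbounded search\<close>

lemma mu_search_eq_Some_iff:
  "mu_search f a = Some v \<longleftrightarrow>
    f (prod_encode (a, v)) = Some 0 \<and> (\<forall>m<v. \<exists>w. f (prod_encode (a, m)) = Some (Suc w))"
  (is "_ \<longleftrightarrow> ?R v")
proof
  assume l: "mu_search f a = Some v"
  then obtain n where n: "f (prod_encode (a, n)) = Some 0" "\<forall>m<n. f (prod_encode (a, m)) \<noteq> None"
    and v: "v = (LEAST n. f (prod_encode (a, n)) = Some 0)"
    unfolding mu_search_def by (auto split: if_splits)
  have "f (prod_encode (a, v)) = Some 0" "v \<le> n"
    unfolding v using n(1) by (auto intro: LeastI Least_le)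
  moreover have "f (prod_encode (a, m)) \<noteq> Some 0" if "m < v" for m
    using that not_less_Least unfolding v by blast
  ultimately show "?R v" using n(2) by (metis less_le_trans not0_implies_Suc not_None_eq)
next
  assume r: "?R v"
  then have "(LEAST n. f (prod_encode (a, n)) = Some 0) = v"
    by (intro Least_equality) (metis, metis not_le option.inject nat.distinct(1))
  moreover have "\<exists>n. f (prod_encode (a, n)) = Some 0 \<and> (\<forall>m<n. f (prod_encode (a, m)) \<noteq> None)"
    using r by (intro exI[of _ v]) auto
  ultimately show "mu_search f a = Some v" unfolding mu_search_def by simp
qed

lemma unbounded_search:
  assumes "decidable t"
  shows "\<exists>\<Phi>. partial_recursive \<Phi> \<and>
    (\<forall>p n. (\<exists>m. t p (prod_encode (n, m))) \<longrightarrow> (\<exists>v. \<Phi> p n = Some v \<and> t p (prod_encode (n, v))))"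
proof -
  let ?\<Phi> = "\<lambda>p. mu_search (\<lambda>x. Some (of_bool (\<not> t p x)))"
  have "total_recursive (\<lambda>p x. of_bool (\<not> t p x))" using assms by (intro recursive_intros)
  then have "partial_recursive ?\<Phi>"
    unfolding total_recursive_def by (rule partial_recursive.mu)
  moreover have "\<exists>v. ?\<Phi> p n = Some v \<and> t p (prod_encode (n, v))"
    if "\<exists>m. t p (prod_encode (n, m))" for p n
  proof -
    from that have "t p (prod_encode (n, LEAST m. t p (prod_encode (n, m))))" by (rule LeastI_ex)
    then show ?thesis
      by (intro exI[of _ "LEAST m. t p (prod_encode (n, m))"])
        (auto simp: mu_search_eq_Some_iff dest: not_less_Least)
  qed
  ultimately show ?thesis by blast
qed

section \<open>Finite prefixes and compactness of Cantor space\<close>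

text \<open>
  A pair \<open>(s, u)\<close> stands for a stage \<open>s\<close> and a finite binary word, coded by the binary digits of
  \<open>u\<close>.  A property holds eventually in this filter if it holds at all late stages for all words
  that share a long enough prefix with \<open>q\<close>.  The required length is fixed beforehand and does not
  grow with \<open>s\<close>; the compactness argument depends on this.
\<close>

definition prefix_filter :: "baire \<Rightarrow> (nat \<times> nat) filter" where
  "prefix_filter q = (INF N. principal {(s, u). N \<le> s \<and> (\<forall>k<N. of_bool (bit u k) = q k)})"

lemma eventually_prefix_filter:
  "eventually P (prefix_filter q) \<longleftrightarrow>
    (\<exists>N. \<forall>s\<ge>N. \<forall>u. (\<forall>k<N. of_bool (bit u k) = q k) \<longrightarrow> P (s, u))"
proof -
  have "eventually P (prefix_filter q) \<longleftrightarrow>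
    (\<exists>N\<in>UNIV. eventually P (principal {(s, u). N \<le> s \<and> (\<forall>k<N. of_bool (bit u k) = q k)}))"
    unfolding prefix_filter_def
  proof (rule eventually_INF_base)
    fix M N :: nat
    show "\<exists>L\<in>UNIV. principal {(s, u). L \<le> s \<and> (\<forall>k<L. of_bool (bit u k) = q k)} \<le>
      inf (principal {(s, u). M \<le> s \<and> (\<forall>k<M. of_bool (bit u k) = q k)})
        (principal {(s, u). N \<le> s \<and> (\<forall>k<N. of_bool (bit u k) = q k)})"
      by (intro bexI[of _ "max M N"]) auto
  qed simp
  then show ?thesis by (auto simp: eventually_principal)
qed

lemma eventually_prefix_filter_bit:
  "eventually (\<lambda>(s, u). k < s \<and> of_bool (bit u k) = q k) (prefix_filter q)"
  unfolding eventually_prefix_filter by (intro exI[of _ "Suc k"]) (simp add: Suc_le_eq)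

text \<open>
  Koenig's lemma: the word \<open>q\<close> is built digit by digit, so that infinitely many of the given words
  continue the part chosen so far.
\<close>

lemma cluster_point_Cantor:
  fixes b :: "nat \<Rightarrow> nat \<Rightarrow> bool"
  shows "\<exists>q. \<forall>N. \<exists>s\<ge>N. \<forall>k<N. b s k = q k"
proof -
  let ?I = "\<lambda>n q. infinite {s. \<forall>k<n. b s k = q k}"
  have "\<exists>w. \<forall>n. ?I n (w n) \<and> (\<forall>k<n. w (Suc n) k = w n k)"
  proof (rule dependent_nat_choice)
    show "\<exists>q. ?I 0 q" by simp
  next
    fix q n assume "?I n q"
    moreover have "{s. \<forall>k<n. b s k = q k} =
      {s. \<forall>k<Suc n. b s k = (q(n := True)) k} \<union> {s. \<forall>k<Suc n. b s k = (q(n := False)) k}"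
      by (auto simp: less_Suc_eq)
    ultimately consider "?I (Suc n) (q(n := True))" | "?I (Suc n) (q(n := False))" by auto
    then show "\<exists>q'. ?I (Suc n) q' \<and> (\<forall>k<n. q' k = q k)" by cases force+
  qed
  then obtain w where w: "\<And>n. ?I n (w n)" "\<And>n k. k < n \<Longrightarrow> w (Suc n) k = w n k" by blast
  \<comment> \<open>The digit at position \<open>k\<close> is settled from the prefix of length \<open>Suc k\<close> on.\<close>
  have stable: "w n k = w (Suc k) k" if "k < n" for n k
    using that
  proof (induction n)
    case (Suc n)
    then show ?case using w(2)[of k n] by (cases "k = n") auto
  qed simp
  have "\<exists>s\<ge>N. \<forall>k<N. b s k = w (Suc k) k" for N
  proof -
    obtain s where "N \<le> s" "\<forall>k<N. b s k = w N k"
      using w(1)[of N] unfolding infinite_nat_iff_unbounded_le by blast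
    then show ?thesis using stable[of _ N] by metis
  qed
  then show ?thesis by (intro exI[of _ "\<lambda>k. w (Suc k) k"]) blast
qed

text \<open>
  If each stage \<open>s\<close> had a counterexample \<open>u s\<close>, then at a cluster point of these words the property
  would fail at arbitrarily late stages on arbitrarily small neighbourhoods.
\<close>

lemma compact_Cantor_stages:
  assumes "\<And>q. (\<And>k. q k \<in> {0, 1}) \<Longrightarrow> eventually (\<lambda>(s, u). P s u) (prefix_filter q)"
  shows "\<exists>s. \<forall>u. P s u"
proof (rule ccontr)
  assume "\<nexists>s. \<forall>u. P s u"
  then obtain u where u: "\<And>s. \<not> P s (u s)" by metis
  obtain q where q: "\<And>N. \<exists>s\<ge>N. \<forall>k<N. bit (u s) k = q k"
    using cluster_point_Cantor[of "\<lambda>s. bit (u s)"] by blast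
  have "eventually (\<lambda>(s, u). P s u) (prefix_filter (\<lambda>k. of_bool (q k)))"
    by (rule assms) simp
  then obtain N where "\<And>s u. s \<ge> N \<Longrightarrow> \<forall>k<N. bit u k = q k \<Longrightarrow> P s u"
    unfolding eventually_prefix_filter of_bool_eq_iff case_prod_conv by blast
  with q[of N] u show False by blast
qed

lemma ex_bits:
  fixes q :: baire
  assumes "\<And>k. q k \<in> {0, 1}"
  shows "\<exists>u::nat. u < 2 ^ s \<and> (\<forall>k<s. of_bool (bit u k) = q k)"
proof -
  let ?u = "horner_sum of_bool 2 (map (\<lambda>k. q k = 1) [0..<s]) :: nat"
  have "?u < 2 ^ s" using horner_sum_of_bool_2_less[of "map (\<lambda>k. q k = 1) [0..<s]"] by simp
  moreover have "of_bool (bit ?u k) = q k" if "k < s" for k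
    using that assms[of k] by (auto simp: bit_horner_sum_bit_iff)
  ultimately show ?thesis by blast
qed

section \<open>Approximating a functional on finite prefixes of its oracle\<close>

text \<open>
  \<open>A\<close> receives a stage \<open>s\<close>, a word \<open>u\<close> and an argument, with value \<open>0\<close> for \<open>no answer yet\<close> and
  \<open>Suc v\<close> for the answer \<open>v\<close>.  An answer must be right for every \<open>q\<close> that agrees with \<open>u\<close> below
  \<open>s\<close>, whatever the later digits of \<open>u\<close> are.  Completeness is
  stated as convergence along the filter, which passes through composition, recursion and search
  because only finitely many intermediate values matter.
\<close>

definition prefix_approximation ::
  "(baire \<Rightarrow> nat \<Rightarrow> nat) \<Rightarrow> (baire \<Rightarrow> nat \<rightharpoonup> nat) \<Rightarrow> bool" where
  "prefix_approximation A \<Phi> \<longleftrightarrow>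
    (\<forall>p q s u n v. (\<forall>k<s. of_bool (bit u k) = q k) \<longrightarrow>
      A p (prod_encode (prod_encode (s, u), n)) = Suc v \<longrightarrow> \<Phi> (baire_pair p q) n = Some v) \<and>
    (\<forall>p q n v. \<Phi> (baire_pair p q) n = Some v \<longrightarrow>
      eventually (\<lambda>c. A p (prod_encode (prod_encode c, n)) = Suc v) (prefix_filter q))"

lemma prefix_approximationI:
  assumes "\<And>p q s u n v. \<forall>k<s. of_bool (bit u k) = q k \<Longrightarrow>
      A p (prod_encode (prod_encode (s, u), n)) = Suc v \<Longrightarrow> \<Phi> (baire_pair p q) n = Some v"
    and "\<And>p q n v. \<Phi> (baire_pair p q) n = Some v \<Longrightarrow>
      eventually (\<lambda>c. A p (prod_encode (prod_encode c, n)) = Suc v) (prefix_filter q)"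
  shows "prefix_approximation A \<Phi>"
  using assms unfolding prefix_approximation_def by blast

lemma prefix_approximation_sound:
  "prefix_approximation A \<Phi> \<Longrightarrow> \<forall>k<s. of_bool (bit u k) = q k \<Longrightarrow>
    A p (prod_encode (prod_encode (s, u), n)) = Suc v \<Longrightarrow> \<Phi> (baire_pair p q) n = Some v"
  unfolding prefix_approximation_def by blast

lemma prefix_approximation_complete:
  "prefix_approximation A \<Phi> \<Longrightarrow> \<Phi> (baire_pair p q) n = Some v \<Longrightarrow>
    eventually (\<lambda>c. A p (prod_encode (prod_encode c, n)) = Suc v) (prefix_filter q)"
  unfolding prefix_approximation_def by blast

lemma prefix_approximation_total:
  assumes "\<And>p n. \<Phi> p n = Some (g n)"
  shows "prefix_approximation (\<lambda>p x. Suc (g (snd (prod_decode x)))) \<Phi>"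
  using assms by (intro prefix_approximationI) auto

abbreviation (input) stage :: "nat \<Rightarrow> nat" where "stage x \<equiv> fst (prod_decode x)"
abbreviation (input) arg :: "nat \<Rightarrow> nat" where "arg x \<equiv> snd (prod_decode x)"

lemma prefix_approximation_query:
  "\<exists>A. total_recursive A \<and> prefix_approximation A (\<lambda>p n. Some (p n))"
proof -
  let ?A = "\<lambda>p x. if even (arg x) then Suc (p (arg x div 2))
    else if arg x div 2 < fst (prod_decode (stage x))
    then Suc (of_bool (bit (snd (prod_decode (stage x))) (arg x div 2))) else 0"
  have "total_recursive ?A" by (intro recursive_intros)
  moreover have "prefix_approximation ?A (\<lambda>p n. Some (p n))"
  proof (rule prefix_approximationI)
    fix p q n v assume "Some (baire_pair p q n) = Some v"
    with eventually_prefix_filter_bit[of "n div 2" q]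
    show "eventually (\<lambda>c. ?A p (prod_encode (prod_encode c, n)) = Suc v) (prefix_filter q)"
      by (auto simp: baire_pair_def elim!: eventually_mono)
  qed (auto simp: baire_pair_def split: if_splits)
  ultimately show ?thesis by blast
qed

lemma prefix_approximation_pair:
  assumes f: "total_recursive f'" "prefix_approximation f' f"
    and g: "total_recursive g'" "prefix_approximation g' g"
  shows "\<exists>A. total_recursive A \<and> prefix_approximation A
    (\<lambda>p n. Option.bind (f p n) (\<lambda>a. Option.bind (g p n) (\<lambda>b. Some (prod_encode (a, b)))))"
proof -
  let ?A = "\<lambda>p x. if f' p x = 0 \<or> g' p x = 0 then 0
    else Suc (prod_encode (f' p x - 1, g' p x - 1))"
  have "total_recursive ?A" by (intro recursive_intros f g)
  moreover have "prefix_approximation ?A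
    (\<lambda>p n. Option.bind (f p n) (\<lambda>a. Option.bind (g p n) (\<lambda>b. Some (prod_encode (a, b)))))"
    (is "prefix_approximation _ ?\<Phi>")
  proof (rule prefix_approximationI)
    fix p s u n v and q :: baire
    assume u: "\<forall>k<s. of_bool (bit u k) = q k"
      and A: "?A p (prod_encode (prod_encode (s, u), n)) = Suc v"
    then have "f' p (prod_encode (prod_encode (s, u), n)) \<noteq> 0"
      "g' p (prod_encode (prod_encode (s, u), n)) \<noteq> 0" by (auto split: if_splits)
    then obtain a b where "f' p (prod_encode (prod_encode (s, u), n)) = Suc a"
      "g' p (prod_encode (prod_encode (s, u), n)) = Suc b" by (meson not0_implies_Suc)
    with A prefix_approximation_sound[OF f(2) u] prefix_approximation_sound[OF g(2) u]
    show "?\<Phi> (baire_pair p q) n = Some v" by auto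
  next
    fix p q n v assume "?\<Phi> (baire_pair p q) n = Some v"
    then obtain a b where a: "f (baire_pair p q) n = Some a" and b: "g (baire_pair p q) n = Some b"
      and v: "v = prod_encode (a, b)" by (auto simp: bind_eq_Some_conv)
    from prefix_approximation_complete[OF f(2) a] prefix_approximation_complete[OF g(2) b]
    show "eventually (\<lambda>c. ?A p (prod_encode (prod_encode c, n)) = Suc v) (prefix_filter q)"
      by eventually_elim (simp add: v)
  qed
  ultimately show ?thesis by blast
qed

lemma prefix_approximation_comp:
  assumes f: "total_recursive f'" "prefix_approximation f' f"
    and g: "total_recursive g'" "prefix_approximation g' g"
  shows "\<exists>A. total_recursive A \<and> prefix_approximation A (\<lambda>p n. Option.bind (g p n) (f p))"
proof -
  let ?A = "\<lambda>p x. if g' p x = 0 then 0 else f' p (prod_encode (stage x, g' p x - 1))"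
  have "total_recursive ?A" by (intro recursive_intros total_recursive_comp[OF f(1)] g)
  moreover have "prefix_approximation ?A (\<lambda>p n. Option.bind (g p n) (f p))"
  proof (rule prefix_approximationI)
    fix p s u n v and q :: baire
    assume u: "\<forall>k<s. of_bool (bit u k) = q k"
      and A: "?A p (prod_encode (prod_encode (s, u), n)) = Suc v"
    then obtain b where "g' p (prod_encode (prod_encode (s, u), n)) = Suc b"
      by (auto split: if_splits dest: gr0_implies_Suc)
    with A prefix_approximation_sound[OF f(2) u] prefix_approximation_sound[OF g(2) u]
    show "Option.bind (g (baire_pair p q) n) (f (baire_pair p q)) = Some v" by auto
  next
    fix p q n v assume "Option.bind (g (baire_pair p q) n) (f (baire_pair p q)) = Some v"
    then obtain b where b: "g (baire_pair p q) n = Some b" and v: "f (baire_pair p q) b = Some v"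
      by (auto simp: bind_eq_Some_conv)
    from prefix_approximation_complete[OF g(2) b] prefix_approximation_complete[OF f(2) v]
    show "eventually (\<lambda>c. ?A p (prod_encode (prod_encode c, n)) = Suc v) (prefix_filter q)"
      by eventually_elim simp
  qed
  ultimately show ?thesis by blast
qed

lemma prefix_approximation_prim:
  assumes f: "total_recursive f'" "prefix_approximation f' f"
    and g: "total_recursive g'" "prefix_approximation g' g"
  shows "\<exists>A. total_recursive A \<and> prefix_approximation A
    (\<lambda>p n. prim_iter (f p) (g p) (fst (prod_decode n)) (snd (prod_decode n)))"
proof -
  define R where "R p c a = rec_nat (f' p (prod_encode (c, a)))
    (\<lambda>m r. if r = 0 then 0
      else g' p (prod_encode (c, prod_encode (a, prod_encode (m, r - 1)))))" for p c a
  let ?A = "\<lambda>p x. R p (stage x) (fst (prod_decode (arg x))) (snd (prod_decode (arg x)))"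
  have "total_recursive ?A" unfolding R_def
    by (intro recursive_intros total_recursive_comp[OF f(1)] total_recursive_comp[OF g(1)])
  moreover have "prefix_approximation ?A
    (\<lambda>p n. prim_iter (f p) (g p) (fst (prod_decode n)) (snd (prod_decode n)))"
  proof (rule prefix_approximationI)
    fix p s u n v and q :: baire
    assume u: "\<forall>k<s. of_bool (bit u k) = q k"
      and A: "?A p (prod_encode (prod_encode (s, u), n)) = Suc v"
    have "prim_iter (f (baire_pair p q)) (g (baire_pair p q)) a m = Some v"
      if "R p (prod_encode (s, u)) a m = Suc v" for a m v
      using that
    proof (induction m arbitrary: v)
      case 0
      then show ?case using prefix_approximation_sound[OF f(2) u] by (simp add: R_def)
    next
      case (Suc m)
      then obtain r where r: "R p (prod_encode (s, u)) a m = Suc r"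
        by (cases "R p (prod_encode (s, u)) a m") (auto simp: R_def)
      with Suc prefix_approximation_sound[OF g(2) u] show ?case
        by (auto simp: R_def split: if_splits)
    qed
    with A show "prim_iter (f (baire_pair p q)) (g (baire_pair p q)) (fst (prod_decode n))
      (snd (prod_decode n)) = Some v" by simp
  next
    fix p q n v
    assume *: "prim_iter (f (baire_pair p q)) (g (baire_pair p q)) (fst (prod_decode n))
      (snd (prod_decode n)) = Some v"
    have "eventually (\<lambda>c. R p (prod_encode c) a m = Suc v) (prefix_filter q)"
      if "prim_iter (f (baire_pair p q)) (g (baire_pair p q)) a m = Some v" for a m v
      using that
    proof (induction m arbitrary: v)
      case 0
      then show ?case using prefix_approximation_complete[OF f(2)] by (simp add: R_def)
    next
      case (Suc m)
      then obtain r where r: "prim_iter (f (baire_pair p q)) (g (baire_pair p q)) a m = Some r"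
        and "g (baire_pair p q) (prod_encode (a, prod_encode (m, r))) = Some v"
        by (auto simp: bind_eq_Some_conv)
      from Suc.IH[OF r] prefix_approximation_complete[OF g(2) this(2)]
      show ?case by eventually_elim (simp add: R_def)
    qed
    with * show "eventually (\<lambda>c. ?A p (prod_encode (prod_encode c, n)) = Suc v) (prefix_filter q)"
      by simp
  qed
  ultimately show ?thesis by blast
qed

text \<open>
  At stage \<open>s\<close> the search is cut off at \<open>s\<close>.  It stops at the first argument whose approximated
  value is missing or is \<open>0\<close>, coded by \<open>0\<close> and \<open>1\<close>, and succeeds only in the second case:
  the search operator diverges if an earlier value is undefined.
\<close>

lemma prefix_approximation_mu:
  assumes f: "total_recursive f'" "prefix_approximation f' f"
  shows "\<exists>A. total_recursive A \<and> prefix_approximation A (\<lambda>p n. mu_search (f p) n)"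
proof -
  define L where "L p c n = (LEAST m. f' p (prod_encode (c, prod_encode (n, m))) \<le> 1 \<or>
    fst (prod_decode c) \<le> m)" for p c n
  let ?A = "\<lambda>p x. if L p (stage x) (arg x) < fst (prod_decode (stage x)) \<and>
      f' p (prod_encode (stage x, prod_encode (arg x, L p (stage x) (arg x)))) = 1
    then Suc (L p (stage x) (arg x)) else 0"
  have "total_recursive ?A" unfolding L_def
    by (intro recursive_intros total_recursive_comp[OF f(1)])
  moreover have "prefix_approximation ?A (\<lambda>p n. mu_search (f p) n)"
  proof (rule prefix_approximationI)
    fix p s u n v and q :: baire
    assume u: "\<forall>k<s. of_bool (bit u k) = q k"
      and A: "?A p (prod_encode (prod_encode (s, u), n)) = Suc v"
    let ?f = "\<lambda>m. f' p (prod_encode (prod_encode (s, u), prod_encode (n, m)))"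
    have v: "v = L p (prod_encode (s, u)) n" "?f v = Suc 0" using A by (auto split: if_splits)
    have "\<exists>w. ?f m = Suc (Suc w)" if "m < v" for m
      using not_less_Least[OF that[unfolded v(1) L_def]]
      by (metis One_nat_def Suc_leI le_0_eq not0_implies_Suc not_less_eq_eq)
    with v(2) show "mu_search (f (baire_pair p q)) n = Some v"
      unfolding mu_search_eq_Some_iff using prefix_approximation_sound[OF f(2) u] by blast
  next
    fix p q n v assume "mu_search (f (baire_pair p q)) n = Some v"
    then have v: "f (baire_pair p q) (prod_encode (n, v)) = Some 0"
      and pos: "\<forall>m<v. \<exists>w. f (baire_pair p q) (prod_encode (n, m)) = Some (Suc w)"
      unfolding mu_search_eq_Some_iff by auto
    have "eventually (\<lambda>c. 1 < f' p (prod_encode (prod_encode c, prod_encode (n, m))))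
        (prefix_filter q)" if "m < v" for m
    proof -
      obtain w where "f (baire_pair p q) (prod_encode (n, m)) = Some (Suc w)" using pos \<open>m < v\<close> by blast
      from prefix_approximation_complete[OF f(2) this] show ?thesis by eventually_elim simp
    qed
    then have "eventually (\<lambda>c. \<forall>m\<in>{..<v}. 1 < f' p (prod_encode (prod_encode c, prod_encode (n, m))))
        (prefix_filter q)" by (intro eventually_ball_finite) auto
    with prefix_approximation_complete[OF f(2) v] eventually_prefix_filter_bit[of v q]
    show "eventually (\<lambda>c. ?A p (prod_encode (prod_encode c, n)) = Suc v) (prefix_filter q)"
    proof eventually_elim
      case (elim c)
      then have "L p (prod_encode c) n = v" unfolding L_def
        by (intro Least_equality) (auto simp: not_less[symmetric] split: prod.splits)
      with elim show ?case by (auto split: prod.splits)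
    qed
  qed
  ultimately show ?thesis by blast
qed

lemma ex_prefix_approximation:
  "partial_recursive \<Phi> \<Longrightarrow> \<exists>A. total_recursive A \<and> prefix_approximation A \<Phi>"
proof (induction rule: partial_recursive.induct)
  case zero
  show ?case
    by (rule exI, rule conjI[rotated], rule prefix_approximation_total[of _ "\<lambda>n. 0"])
      (simp, intro recursive_intros)
next
  case succ
  show ?case
    by (rule exI, rule conjI[rotated], rule prefix_approximation_total[of _ Suc])
      (simp, intro recursive_intros)
next
  case left
  show ?case
    by (rule exI, rule conjI[rotated], rule prefix_approximation_total[of _ "\<lambda>n. fst (prod_decode n)"])
      (simp, intro recursive_intros)
next
  case right
  show ?case
    by (rule exI, rule conjI[rotated], rule prefix_approximation_total[of _ "\<lambda>n. snd (prod_decode n)"])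
      (simp, intro recursive_intros)
next
  case query
  show ?case by (rule prefix_approximation_query)
qed (blast intro: prefix_approximation_pair prefix_approximation_comp prefix_approximation_prim
  prefix_approximation_mu)+

section \<open>Single-valued problems below LLPO\<close>

lemma LLPO_iff:
  assumes "LLPO p \<noteq> {}"
  shows "i \<in> LLPO p \<longleftrightarrow> i \<in> {0, 1} \<and> (\<forall>n. p (2 * n + i) = 0)"
proof -
  have "Uniq (\<lambda>k. p k \<noteq> 0)" using assms unfolding LLPO_def by metis
  then show ?thesis by (cases "i = 0"; cases "i = 1") (auto simp: LLPO_def)
qed

lemma LLPO_hat_iff:
  assumes "LLPO_hat r \<noteq> {}"
  shows "q \<in> LLPO_hat r \<longleftrightarrow>
    (\<forall>k. q k \<in> {0, 1} \<and> (\<forall>n. r (prod_encode (k, 2 * n + q k)) = 0))"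
proof -
  have "LLPO (\<lambda>n. r (prod_encode (k, n))) \<noteq> {}" for k
    using assms unfolding LLPO_hat_def by blast
  then show ?thesis unfolding LLPO_hat_def by (simp add: LLPO_iff)
qed

text \<open>
  The reduction works for all realizers \<open>G\<close>.  Taking \<open>G\<close> undefined outside the domain shows
  that the computed instance \<open>r\<close> is solvable; changing the value of \<open>G\<close> at \<open>r\<close> to an arbitrary
  solution \<open>q\<close> shows that every solution leads to a value of \<open>f\<close>.
\<close>

lemma weihrauch_reducible_LLPO_hatE:
  assumes "weihrauch_reducible \<delta>X \<delta>Y f Some Some LLPO_hat"
  obtains \<Phi> \<Psi> where "partial_recursive \<Phi>" "partial_recursive \<Psi>"
    "\<And>p x. \<delta>X p = Some x \<Longrightarrow> x \<in> multifun_dom f \<Longrightarrow>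
      \<exists>r. (\<forall>n. \<Psi> p n = Some (r n)) \<and> LLPO_hat r \<noteq> {} \<and>
        (\<forall>q\<in>LLPO_hat r. \<exists>z y. (\<forall>n. \<Phi> (baire_pair p q) n = Some (z n)) \<and>
          \<delta>Y z = Some y \<and> y \<in> f x)"
proof -
  obtain H K where "computable_baire H" "computable_baire K"
    and red: "\<And>G. realizer Some Some LLPO_hat G \<Longrightarrow> realizer \<delta>X \<delta>Y f
      (\<lambda>p. Option.bind (K p) (\<lambda>r. Option.bind (G r) (\<lambda>q. H (baire_pair p q))))"
    using assms unfolding weihrauch_reducible_def by blast
  then obtain \<Phi> \<Psi> where \<Phi>: "partial_recursive \<Phi>" "\<And>p q n. H p = Some q \<Longrightarrow> \<Phi> p n = Some (q n)"
    and \<Psi>: "partial_recursive \<Psi>" "\<And>p q n. K p = Some q \<Longrightarrow> \<Psi> p n = Some (q n)"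
    unfolding computable_baire_def by metis
  show thesis
  proof (rule that[OF \<Phi>(1) \<Psi>(1)])
    fix p x assume p: "\<delta>X p = Some x" "x \<in> multifun_dom f"
    have step: "\<exists>r q z y. K p = Some r \<and> G r = Some q \<and> H (baire_pair p q) = Some z \<and>
      \<delta>Y z = Some y \<and> y \<in> f x" if "realizer Some Some LLPO_hat G" for G
      using red[OF that] p unfolding realizer_def by (fastforce simp: bind_eq_Some_conv)
    \<comment> \<open>A realizer that answers \<open>q\<close> at \<open>r\<close> if this is admissible, and is undefined off the domain.\<close>
    define choice where "choice r q r' =
      (if LLPO_hat r' = {} then None
       else if r' = r \<and> q \<in> LLPO_hat r then Some q else Some (SOME q. q \<in> LLPO_hat r'))"
      for r q r'
    have choice: "realizer Some Some LLPO_hat (choice r q)" for r q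
      unfolding realizer_def choice_def multifun_dom_def by (auto simp: some_in_eq)
    obtain r q where r: "K p = Some r" and "choice undefined undefined r = Some q"
      using step[OF choice] by blast
    then have ne: "LLPO_hat r \<noteq> {}" by (auto simp: choice_def)
    have "\<exists>z y. H (baire_pair p q) = Some z \<and> \<delta>Y z = Some y \<and> y \<in> f x"
      if "q \<in> LLPO_hat r" for q
    proof -
      obtain r' q' z y where "K p = Some r'" "choice r q r' = Some q'"
        "H (baire_pair p q') = Some z" "\<delta>Y z = Some y" "y \<in> f x"
        using step[OF choice[of r q]] by blast
      moreover have "choice r q r = Some q" using ne that by (simp add: choice_def)
      ultimately show ?thesis using r by auto
    qed
    with ne show "\<exists>r. (\<forall>n. \<Psi> p n = Some (r n)) \<and> LLPO_hat r \<noteq> {} \<and>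
        (\<forall>q\<in>LLPO_hat r. \<exists>z y. (\<forall>n. \<Phi> (baire_pair p q) n = Some (z n)) \<and>
          \<delta>Y z = Some y \<and> y \<in> f x)"
      using \<Phi>(2) \<Psi>(2)[OF r] by meson
  qed
qed

text \<open>
  The digit at position \<open>j\<close> of a solution is the parity class on which the \<open>j\<close>th component of \<open>r\<close>
  has to vanish, so a single nonzero entry there rules out all words with that digit.
\<close>

definition refuted :: "baire \<Rightarrow> nat \<Rightarrow> nat \<Rightarrow> bool" where
  "refuted r s u \<longleftrightarrow> (\<exists>j<s. \<exists>n<s. r (prod_encode (j, 2 * n + of_bool (bit u j))) \<noteq> 0)"

lemma not_refuted:
  assumes "q \<in> LLPO_hat r" and "\<forall>k<s. of_bool (bit u k) = q k"
  shows "\<not> refuted r s u"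
  using assms LLPO_hat_iff[of r q] unfolding refuted_def by auto

lemma eventually_refuted:
  assumes "LLPO_hat r \<noteq> {}" and q: "\<And>k. q k \<in> {0, 1}" "q \<notin> LLPO_hat r"
  shows "eventually (\<lambda>(s, u). refuted r s u) (prefix_filter q)"
proof -
  obtain j n where jn: "r (prod_encode (j, 2 * n + q j)) \<noteq> 0"
    using LLPO_hat_iff[OF assms(1), of q] q by blast
  from eventually_prefix_filter_bit[of j q] eventually_prefix_filter_bit[of n q]
  show ?thesis
  proof eventually_elim
    case (elim c)
    obtain s u where c: "c = (s, u)" by (cases c)
    from elim jn have "j < s" "n < s" "r (prod_encode (j, 2 * n + of_bool (bit u j))) \<noteq> 0"
      by (simp_all add: c)
    then show ?case unfolding refuted_def c by blast
  qed
qed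

text \<open>
  Comparing real numbers is undecidable, but a decidable \<open>t\<close> can separate values up to
  \<open>(1/2) ^ Suc k\<close> from values above \<open>(1/2) ^ k\<close>: it compares an approximation with error at most
  a quarter of \<open>(1/2) ^ k\<close> to three quarters of \<open>(1/2) ^ k\<close>.
\<close>

lemma computable_real_double_seq_decidable_gap:
  assumes "computable_real_double_seq x"
  shows "\<exists>t. decidable (\<lambda>p. t) \<and>
    (\<forall>k i j. (t (prod_encode (k, prod_encode (i, j))) \<longrightarrow> x i j \<le> (1/2) ^ k) \<and>
      (x i j \<le> (1/2) ^ Suc k \<longrightarrow> t (prod_encode (k, prod_encode (i, j)))))"
proof -
  obtain s a b where c: "computable_nat s" "computable_nat a" "computable_nat b"
    and b: "\<And>n. b n \<noteq> 0"
    and approx: "\<And>i j k. \<bar>x i j - (-1) ^ s (prod_encode (i, prod_encode (j, k))) *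
      real (a (prod_encode (i, prod_encode (j, k)))) / real (b (prod_encode (i, prod_encode (j, k))))\<bar>
      \<le> (1/2) ^ k"
    using assms unfolding computable_real_double_seq_def Let_def by blast
  define e where "e y = prod_encode (fst (prod_decode (snd (prod_decode y))),
    prod_encode (snd (prod_decode (snd (prod_decode y))), fst (prod_decode y) + 2))" for y
  let ?t = "\<lambda>y. odd (s (e y)) \<or> a (e y) * 2 ^ (fst (prod_decode y) + 2) \<le> 3 * b (e y)"
  have "decidable (\<lambda>p. ?t)" unfolding e_def
    by (intro recursive_intros c[THEN total_recursive_computable_nat])
  moreover have "(?t y \<longrightarrow> x i j \<le> (1/2) ^ k) \<and> (x i j \<le> (1/2) ^ Suc k \<longrightarrow> ?t y)"
    if y: "y = prod_encode (k, prod_encode (i, j))" for k i j y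
  proof -
    define D where "D = (-1) ^ s (e y) * real (a (e y)) / real (b (e y))"
    have "\<bar>x i j - D\<bar> \<le> (1/2) ^ (k + 2)"
      using approx[of i j "k + 2"] by (simp add: D_def e_def y)
    also have "\<dots> = 1/4 * (1/2) ^ k" by (simp add: power_add)
    finally have bounds: "D \<le> 3/4 * (1/2) ^ k \<longrightarrow> x i j \<le> (1/2) ^ k"
      "x i j \<le> 1/2 * (1/2) ^ k \<longrightarrow> D \<le> 3/4 * (1/2) ^ k" by linarith+
    have bpos: "0 < real (b (e y))" using b by simp
    have "?t y \<longleftrightarrow> D \<le> 3/4 * (1/2) ^ k"
    proof (cases "odd (s (e y))")
      case True
      then have "D \<le> 0" by (simp add: D_def)
      also have "0 \<le> 3 / 4 * (1/2 :: real) ^ k" by simp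
      finally show ?thesis using True by simp
    next
      case False
      have "a (e y) * 2 ^ (k + 2) \<le> 3 * b (e y) \<longleftrightarrow>
        real (a (e y)) * 2 ^ (k + 2) \<le> 3 * real (b (e y))"
        by (simp flip: of_nat_le_iff[where 'a = real])
      with False bpos show ?thesis
        by (simp add: D_def y field_simps power_add)
    qed
    with bounds show ?thesis unfolding power_Suc by blast
  qed
  ultimately show ?thesis by (intro exI[of _ ?t]) simp
qed

context Metric_space
begin

lemma cauchy_name_dist_le:
  assumes \<alpha>: "range \<alpha> \<subseteq> M" and p: "cauchy_name M d \<alpha> p y"
  shows "d (\<alpha> (p j)) y \<le> (1/2) ^ j"
proof -
  have lim: "(\<lambda>i. d (\<alpha> (p i)) y) \<longlonglongrightarrow> 0" and y: "y \<in> M"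
    using p unfolding cauchy_name_def limitin_metric_dist_null by auto
  have "d (\<alpha> (p j)) y \<le> (1/2) ^ j + d (\<alpha> (p i)) y" if "i > j" for i
  proof -
    have "d (\<alpha> (p j)) y \<le> d (\<alpha> (p j)) (\<alpha> (p i)) + d (\<alpha> (p i)) y"
      using \<alpha> y by (intro triangle) auto
    moreover have "d (\<alpha> (p i)) (\<alpha> (p j)) \<le> (1/2) ^ j"
      using p that unfolding cauchy_name_def by blast
    ultimately show ?thesis by (simp add: commute)
  qed
  then have "\<forall>\<^sub>F i in sequentially. d (\<alpha> (p j)) y \<le> (1/2) ^ j + d (\<alpha> (p i)) y"
    by (intro eventually_sequentiallyI[of "Suc j"]) simp
  moreover have "(\<lambda>i. (1/2) ^ j + d (\<alpha> (p i)) y) \<longlonglongrightarrow> (1/2) ^ j + 0"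
    by (intro tendsto_intros lim)
  ultimately show ?thesis
    using tendsto_lowerbound[of _ _ sequentially] by fastforce
qed

text \<open>
  The error \<open>(1/2) ^ Suc k\<close> leaves room for two such errors in the Cauchy condition.
\<close>

lemma cauchy_nameI_dist_le:
  assumes \<alpha>: "range \<alpha> \<subseteq> M" and y: "y \<in> M" and p: "\<And>k. d (\<alpha> (p k)) y \<le> (1/2) ^ Suc k"
  shows "cauchy_name M d \<alpha> p y"
  unfolding cauchy_name_def
proof (intro conjI allI impI)
  fix i j :: nat assume "i > j"
  have "d (\<alpha> (p i)) (\<alpha> (p j)) \<le> d (\<alpha> (p i)) y + d (\<alpha> (p j)) y"
    using triangle[of "\<alpha> (p i)" y "\<alpha> (p j)"] \<alpha> y by (auto simp: commute)
  also have "\<dots> \<le> (1/2) ^ Suc i + (1/2) ^ Suc j" using p by (intro add_mono)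
  also have "\<dots> \<le> (1/2) ^ Suc j + (1/2) ^ Suc j"
    using \<open>i > j\<close> by (intro add_mono power_decreasing) auto
  finally show "d (\<alpha> (p i)) (\<alpha> (p j)) \<le> (1/2) ^ j" by simp
next
  have "(\<lambda>k. (1/2::real) ^ Suc k) \<longlonglongrightarrow> 0"
    by (intro LIMSEQ_Suc LIMSEQ_power_zero) simp
  then have "(\<lambda>k. d (\<alpha> (p k)) y) \<longlonglongrightarrow> 0"
    by (rule Lim_null_comparison[rotated]) (use p in \<open>auto intro!: always_eventually\<close>)
  then show "limitin mtopology (\<lambda>i. \<alpha> (p i)) y sequentially"
    using \<alpha> y unfolding limitin_metric_dist_null by (auto intro!: always_eventually)
qed

end

theorem corollary8p8:
  fixes X :: "'x set" and \<delta>X :: "baire \<rightharpoonup> 'x"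
    and Y :: "'y set" and d :: "'y \<Rightarrow> 'y \<Rightarrow> real" and \<alpha> :: "nat \<Rightarrow> 'y"
    and f :: "'x \<Rightarrow> 'y set"
  assumes "represented_space X \<delta>X"
    and "computable_metric_space Y d \<alpha>"
    and "multifun X Y f"
    and "single_valued_multifun f"
    and "weakly_computable \<delta>X (cauchy_rep Y d \<alpha>) f"
  shows "computable_multifun \<delta>X (cauchy_rep Y d \<alpha>) f"
proof -
  interpret Metric_space Y d
    using assms(2) by (simp add: computable_metric_space_def)
  have \<alpha>: "range \<alpha> \<subseteq> Y" and dense: "mtopology closure_of range \<alpha> = Y"
    and comp: "computable_real_double_seq (\<lambda>i j. d (\<alpha> i) (\<alpha> j))"
    using assms(2) by (auto simp: computable_metric_space_def)
  then have \<alpha>_in: "\<alpha> i \<in> Y" for i by auto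
  obtain \<Phi> \<Psi> where \<Phi>: "partial_recursive \<Phi>" and \<Psi>: "partial_recursive \<Psi>"
    and red: "\<And>p x. \<delta>X p = Some x \<Longrightarrow> x \<in> multifun_dom f \<Longrightarrow>
      \<exists>r. (\<forall>n. \<Psi> p n = Some (r n)) \<and> LLPO_hat r \<noteq> {} \<and>
        (\<forall>q\<in>LLPO_hat r. \<exists>z y. (\<forall>n. \<Phi> (baire_pair p q) n = Some (z n)) \<and>
          cauchy_rep Y d \<alpha> z = Some y \<and> y \<in> f x)"
    using weihrauch_reducible_LLPO_hatE[OF assms(5)[unfolded weakly_computable_def]] by blast
  obtain A where A: "total_recursive A" "prefix_approximation A \<Phi>"
    using ex_prefix_approximation[OF \<Phi>] by blast
  obtain t where t: "decidable (\<lambda>p. t)"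
    and t_sound: "\<And>k i j. t (prod_encode (k, prod_encode (i, j))) \<Longrightarrow> d (\<alpha> i) (\<alpha> j) \<le> (1/2) ^ k"
    and t_complete: "\<And>k i j. d (\<alpha> i) (\<alpha> j) \<le> (1/2) ^ Suc k \<Longrightarrow>
      t (prod_encode (k, prod_encode (i, j)))"
    using computable_real_double_seq_decidable_gap[OF comp] by blast
  \<comment> \<open>To output \<open>i\<close> with \<open>\<alpha> i\<close> within \<open>(1/2) ^ Suc k\<close> of \<open>y\<close>, entry \<open>k + 4\<close> of the name of \<open>y\<close> is used,
    which has error \<open>(1/2) ^ (k + 4)\<close>.  An \<open>\<alpha> i\<close> equally close to \<open>y\<close> is then within
    \<open>(1/2) ^ (k + 3)\<close> of that entry and passes the test \<open>t\<close> at \<open>k + 2\<close>.  Conversely, passing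
    gives a distance to \<open>y\<close> of at most \<open>(1/2) ^ (k + 2) + (1/2) ^ (k + 4)\<close>.\<close>
  define close where "close p k s i u \<longleftrightarrow>
    (let w = A p (prod_encode (prod_encode (s, u), k + 4))
     in w \<noteq> 0 \<and> t (prod_encode (k + 2, prod_encode (w - 1, i))))" for p k s i u
  define found where "found p r k s i \<longleftrightarrow> (\<forall>u < 2 ^ s. refuted r s u \<or> close p k s i u)"
    for p r k s i
  \<comment> \<open>The search is a functional of the oracle \<open>\<langle>p, r\<rangle>\<close>, from which \<open>?l\<close> and \<open>?r\<close> recover the halves.\<close>
  let ?l = "\<lambda>h n. h (2 * n)" and ?r = "\<lambda>h n. h (2 * n + 1)"
  have "decidable (\<lambda>h x. found (?l h) (?r h) (fst (prod_decode x))
    (fst (prod_decode (snd (prod_decode x)))) (snd (prod_decode (snd (prod_decode x)))))"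
    unfolding found_def refuted_def close_def Let_def
    by (intro recursive_intros decidable_comp[OF t]
        total_recursive_comp[OF total_recursive_oracle_substitution[OF A(1), of ?l]])
  from unbounded_search[OF this] obtain S where S: "partial_recursive S"
    "\<And>h k. (\<exists>m. found (?l h) (?r h) k (fst (prod_decode m)) (snd (prod_decode m))) \<Longrightarrow>
      \<exists>m. S h k = Some m \<and> found (?l h) (?r h) k (fst (prod_decode m)) (snd (prod_decode m))"
    by auto
  have pair: "?l (baire_pair p r) = p" "?r (baire_pair p r) = r" for p r
    by (auto simp: baire_pair_def)
  have half: "total_recursive (\<lambda>p n. n div 2)"
    and interleave: "total_recursive (\<lambda>p x. if even (fst (prod_decode x))
      then p (fst (prod_decode x) div 2) else snd (prod_decode x))"
    by (intro recursive_intros)+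
  \<comment> \<open>\<open>?\<Psi>'\<close> computes \<open>\<langle>p, r\<rangle>\<close> from \<open>p\<close>.  It runs \<open>\<Psi>\<close> at even arguments as well; this does no harm
    at the relevant \<open>p\<close>, where \<open>\<Psi>\<close> converges everywhere.\<close>
  let ?\<Psi>' = "\<lambda>p n. Option.bind (\<Psi> p (n div 2)) (\<lambda>v. Some (if even n then p (n div 2) else v))"
  have "partial_recursive ?\<Psi>'"
    using partial_recursive.comp[OF interleave[unfolded total_recursive_def]
        partial_recursive.pair[OF total_recursive_id[unfolded total_recursive_def]
          partial_recursive.comp[OF \<Psi> half[unfolded total_recursive_def]]]]
    by (simp cong: if_cong)
  from oracle_substitution[OF S(1) this] obtain \<Theta> where \<Theta>: "partial_recursive \<Theta>"
    "\<And>p h. (\<forall>n. ?\<Psi>' p n = Some (h n)) \<Longrightarrow> \<Theta> p = S h" by blast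
  have \<Theta>_eq: "\<Theta> p = S (baire_pair p r)" if "\<forall>n. \<Psi> p n = Some (r n)" for p r
    by (rule \<Theta>(2)) (use that in \<open>simp add: baire_pair_def\<close>)
  define \<Omega> where "\<Omega> p k = Option.bind (\<Theta> p k) (\<lambda>m. Some (snd (prod_decode m)))" for p k
  have "partial_recursive \<Omega>"
    using partial_recursive.comp[OF partial_recursive.right \<Theta>(1)] by (simp add: \<Omega>_def[abs_def])
  define F where "F p = (if \<forall>n. \<Omega> p n \<noteq> None then Some (\<lambda>n. the (\<Omega> p n)) else None)" for p
  have "computable_baire F"
    unfolding computable_baire_def F_def using \<open>partial_recursive \<Omega>\<close>
    by (intro exI[of _ \<Omega>]) (auto split: if_splits)
  moreover have "realizer \<delta>X (cauchy_rep Y d \<alpha>) f F"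
    unfolding realizer_def
  proof (intro allI impI, elim conjE)
    fix p x assume p: "\<delta>X p = Some x" "x \<in> multifun_dom f"
    obtain y where fx: "f x = {y}"
      using assms(4) p(2) unfolding single_valued_multifun_def is_singleton_def by blast
    have y: "y \<in> Y" using assms(3) p(2) fx unfolding multifun_def by blast
    obtain r where r: "\<forall>n. \<Psi> p n = Some (r n)" "LLPO_hat r \<noteq> {}"
      and "\<forall>q\<in>LLPO_hat r. \<exists>z y. (\<forall>n. \<Phi> (baire_pair p q) n = Some (z n)) \<and>
        cauchy_rep Y d \<alpha> z = Some y \<and> y \<in> f x"
      using red[OF p] by blast
    then have names: "\<exists>z. (\<forall>n. \<Phi> (baire_pair p q) n = Some (z n)) \<and> cauchy_name Y d \<alpha> z y"
      if "q \<in> LLPO_hat r" for q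
      using that fx by (simp add: cauchy_rep_eq_Some_iff[OF Metric_space_axioms])
    have near: "\<exists>w. \<Phi> (baire_pair p q) n = Some w \<and> d (\<alpha> w) y \<le> (1/2) ^ n"
      if "q \<in> LLPO_hat r" for q n
      using names[OF that] cauchy_name_dist_le[OF \<alpha>] by blast
    have sound: "d (\<alpha> i) y \<le> (1/2) ^ Suc k" if found: "found p r k s i" for k s i
    proof -
      obtain q where q: "q \<in> LLPO_hat r" using r(2) by blast
      then have "q k \<in> {0, 1}" for k using LLPO_hat_iff[OF r(2)] by blast
      then obtain u :: nat where u: "u < 2 ^ s" "\<forall>k<s. of_bool (bit u k) = q k"
        using ex_bits[of q s] by blast
      with found not_refuted[OF q] have "close p k s i u" unfolding found_def by blast
      then obtain w where w: "A p (prod_encode (prod_encode (s, u), k + 4)) = Suc w"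
        and "t (prod_encode (k + 2, prod_encode (w, i)))"
        unfolding close_def Let_def by (metis diff_Suc_1 not0_implies_Suc)
      from t_sound[OF this(2)] have wi: "d (\<alpha> w) (\<alpha> i) \<le> (1/2) ^ (k + 2)" .
      from near[OF q, of "k + 4"] prefix_approximation_sound[OF A(2), OF u(2) w]
      have "d (\<alpha> w) y \<le> (1/2) ^ (k + 4)" by simp
      moreover have "d (\<alpha> i) y \<le> d (\<alpha> i) (\<alpha> w) + d (\<alpha> w) y"
        using \<alpha>_in y by (intro triangle)
      moreover have "(1/2) ^ (k + 2) + (1/2) ^ (k + 4) \<le> (1/2 :: real) ^ Suc k"
        by (simp add: power_add power4_eq_xxxx)
      ultimately show ?thesis using wi commute[of "\<alpha> i" "\<alpha> w"] by linarith
    qed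
    have complete: "\<exists>s i. found p r k s i" for k
    proof -
      have "y \<in> mtopology closure_of range \<alpha>" using y dense by simp
      moreover have "(0::real) < (1/2) ^ (k + 4)" by simp
      ultimately have "\<exists>z \<in> range \<alpha>. z \<in> mball y ((1/2) ^ (k + 4))"
        unfolding metric_closure_of by blast
      then obtain i where i: "d y (\<alpha> i) < (1/2) ^ (k + 4)" by auto
      have "\<exists>s. \<forall>u. refuted r s u \<or> close p k s i u"
      proof (rule compact_Cantor_stages)
        fix q :: baire assume bits: "\<And>k. q k \<in> {0, 1}"
        show "\<forall>\<^sub>F (s, u) in prefix_filter q. refuted r s u \<or> close p k s i u"
        proof (cases "q \<in> LLPO_hat r")
          case True
          then obtain w where w: "\<Phi> (baire_pair p q) (k + 4) = Some w"
            "d (\<alpha> w) y \<le> (1/2) ^ (k + 4)" using near by blast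
          have "d (\<alpha> w) (\<alpha> i) \<le> d (\<alpha> w) y + d y (\<alpha> i)"
            using \<alpha>_in y by (intro triangle)
          also have "\<dots> \<le> (1/2) ^ (k + 4) + (1/2) ^ (k + 4)" using w(2) i by simp
          also have "\<dots> = (1/2) ^ Suc (k + 2)" by (simp add: power_add power4_eq_xxxx)
          finally have "t (prod_encode (k + 2, prod_encode (w, i)))" by (rule t_complete)
          with prefix_approximation_complete[OF A(2) w(1)] show ?thesis
            by (auto simp: close_def elim!: eventually_mono)
        next
          case False
          from eventually_refuted[OF r(2) bits this] show ?thesis
            by (auto elim!: eventually_mono)
        qed
      qed
      then show ?thesis unfolding found_def by blast
    qed
    have "\<exists>i. \<Omega> p k = Some i \<and> d (\<alpha> i) y \<le> (1/2) ^ Suc k" for k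
    proof -
      obtain s i where "found p r k s i" using complete by blast
      then have "\<exists>m. found p r k (fst (prod_decode m)) (snd (prod_decode m))"
        by (intro exI[of _ "prod_encode (s, i)"]) simp
      with S(2)[of "baire_pair p r" k, unfolded pair] obtain m where
        "S (baire_pair p r) k = Some m" "found p r k (fst (prod_decode m)) (snd (prod_decode m))"
        by blast
      with sound show ?thesis by (auto simp: \<Omega>_def \<Theta>_eq[OF r(1)])
    qed
    then obtain g where g: "\<And>k. \<Omega> p k = Some (g k)" "\<And>k. d (\<alpha> (g k)) y \<le> (1/2) ^ Suc k"
      by metis
    from cauchy_nameI_dist_le[OF \<alpha> y g(2)] g(1)
    show "\<exists>q y. F p = Some q \<and> cauchy_rep Y d \<alpha> q = Some y \<and> y \<in> f x"
      by (auto simp: F_def fx cauchy_rep_eq_Some_iff[OF Metric_space_axioms])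
  qed
  ultimately show ?thesis unfolding computable_multifun_def by blast
qed

end
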